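(* Let $c\ge1$ be an absolute constant such that for all integers $k\ge1$, \[\sum_{i=1}^{k-1}\left(\frac ki\right)^{i/2}\left(\frac k{k-i}\right)^{(k-i)/2}\frac{1}{\sqrt{i(k-i)}}\le c\sqrt{\frac{2^k}{k}}.\] Then for all positive integers $n$ and $k$, \[ \pi(\mathcal{P}_{n,k})\leq\frac{(2+\sqrt2)^{k-1}c^{k-1}}{\sqrt k}\left(\frac{2n}{k}\right)^{k/2}. \]
   Context: $\mathcal P_{n,k}$ is the family of all $k$-element subsets of $\{1,\dots,n\}$. For families $\mathcal A,\mathcal B$ of finite subsets of $\mathbb Z$, $\mathcal A*\mathcal B=\{A\cup B: A\in\mathcal A,B\in\mathcal B\}$. An integer interval is a finite set of consecutive integers $\{i,i+1,\dots,j\}$, including the empty set. An elementary family is any family $\binom{I_1}{k_1}*\binom{I_2}{k_2}*\cdots*\binom{I_\ell}{k_\ell}$ where $\ell\ge1$, $I_1,\dots,I_\ell$ are pairwise disjoint integer intervals, $k_1,\dots,k_\ell\in\{0,1,2\}$, and $\binom{I}{j}$ is the family of $j$-element subsets of $I$. For $\mathcal A\subseteq\mathcal P(\{1,\dots,n\})$, $\pi(\mathcal A)$ is the minimum of $\sum_{i=1}^N|\mathcal E_i|^{1/2}$ over all $N$ and all pairwise disjoint elementary families $\mathcal E_1,\dots,\mathcal E_N$ with $\mathcal E_1\cup\dots\cup\mathcal E_N=\mathcal A$. *)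

theory Defs
  imports Complex_Main "HOL-Library.Ramsey" "HOL-Library.Disjoint_Sets"
begin

definition family_join :: "int set set \<Rightarrow> int set set \<Rightarrow> int set set" where
  "family_join \<A> \<B> = {A \<union> B | A B. A \<in> \<A> \<and> B \<in> \<B>}"

definition int_interval :: "int set \<Rightarrow> bool" where
  "int_interval I \<longleftrightarrow> (\<exists>a b. I = {a..b})"

text \<open>The library's \<^term>\<open>nsets I j\<close> is the family of all \<open>j\<close>-element subsets of \<open>I\<close>.
  The family \<open>{{}}\<close> is the neutral element of \<^const>\<open>family_join\<close>.\<close>

definition elementary_family :: "int set set \<Rightarrow> bool" where
  "elementary_family \<E> \<longleftrightarrow>
     (\<exists>l I k. l \<ge> (1::nat) \<and> (\<forall>j<l. int_interval (I j) \<and> k j \<in> {0, 1, 2}) \<and>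
        disjoint_family_on I {..<l} \<and>
        \<E> = foldr family_join (map (\<lambda>j. nsets (I j) (k j)) [0..<l]) {{}})"

definition elementary_partition :: "int set set \<Rightarrow> nat \<Rightarrow> (nat \<Rightarrow> int set set) \<Rightarrow> bool" where
  "elementary_partition \<A> N \<E> \<longleftrightarrow>
     (\<forall>i<N. elementary_family (\<E> i)) \<and> disjoint_family_on \<E> {..<N} \<and> (\<Union>i<N. \<E> i) = \<A>"

definition partition_cost :: "nat \<Rightarrow> (nat \<Rightarrow> int set set) \<Rightarrow> real" where
  "partition_cost N \<E> = (\<Sum>i<N. sqrt (real (card (\<E> i))))"

text \<open>The infimum is attained whenever \<open>\<A>\<close> is a family of subsets of a finite set,
  see \<open>elem_pi_attained\<close> below.\<close>

definition elem_pi :: "int set set \<Rightarrow> real" where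
  "elem_pi \<A> = Inf {partition_cost N \<E> | N \<E>. elementary_partition \<A> N \<E>}"

definition k_subsets :: "nat \<Rightarrow> nat \<Rightarrow> int set set" where
  "k_subsets n k = nsets {1..int n} k"

lemma elementary_singleton:
  assumes "finite A"
  shows "elementary_family {A}"
proof (cases "A = {}")
  case True
  have "{A} = foldr family_join (map (\<lambda>j. nsets ((\<lambda>_. {1..0}) j) ((\<lambda>_. 0) j)) [0..<1]) {{}}"
    using True by (auto simp: family_join_def nsets_def)
  moreover have "int_interval {1..0}"
    unfolding int_interval_def by blast
  ultimately show ?thesis
    unfolding elementary_family_def disjoint_family_on_def
    by (intro exI[of _ 1] exI[of _ "\<lambda>_. {1..0}"] exI[of _ "\<lambda>_. 0"]) auto
next
  case False
  obtain xs where xs: "set xs = A" "distinct xs"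
    using finite_distinct_list[OF assms] by blast
  have single: "nsets {a} 1 = {{a}}" for a :: int
    by (auto simp: nsets_def card_1_singleton_iff)
  have join: "foldr family_join (map (\<lambda>a. {{a}}) ys) {{}} = {set ys}" for ys
    by (induction ys) (auto simp: family_join_def)
  have "map (\<lambda>j. nsets {xs ! j} 1) [0..<length xs] = map (\<lambda>a. {{a}}) xs"
    by (rule nth_equalityI) (auto simp: single simp del: One_nat_def)
  then have "{A} = foldr family_join (map (\<lambda>j. nsets {xs ! j} 1) [0..<length xs]) {{}}"
    using join[of xs] xs by simp
  moreover have "disjoint_family_on (\<lambda>j. {xs ! j}) {..<length xs}"
    using xs by (auto simp: disjoint_family_on_def nth_eq_iff_index_eq)
  moreover have "int_interval {a}" for a
    unfolding int_interval_def by (intro exI[of _ a]) simp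
  moreover have "length xs \<ge> 1"
    using False xs by (cases xs) auto
  ultimately show ?thesis
    unfolding elementary_family_def
    by (intro exI[of _ "length xs"] exI[of _ "\<lambda>j. {xs ! j}"] exI[of _ "\<lambda>_. 1"]) blast
qed

lemma elem_pi_attained:
  assumes "finite X" "\<A> \<subseteq> Pow X"
  shows "\<exists>N \<E>. elementary_partition \<A> N \<E> \<and> elem_pi \<A> = partition_cost N \<E>"
    and "elementary_partition \<A> N \<E> \<Longrightarrow> elem_pi \<A> \<le> partition_cost N \<E>"
proof -
  let ?V = "{partition_cost N \<E> | N \<E>. elementary_partition \<A> N \<E>}"
  have finA: "finite \<A>"
    using assms by (meson finite_Pow_iff finite_subset)
  have "?V \<subseteq> (\<lambda>\<F>. \<Sum>F\<in>\<F>. sqrt (real (card F))) ` Pow (Pow \<A>)"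
  proof
    fix v assume "v \<in> ?V"
    then obtain N \<E> where p: "elementary_partition \<A> N \<E>" and v: "v = partition_cost N \<E>"
      by blast
    define J where "J = {i \<in> {..<N}. \<E> i \<noteq> {}}"
    have dis: "disjoint_family_on \<E> {..<N}" and un: "(\<Union>i<N. \<E> i) = \<A>"
      using p by (auto simp: elementary_partition_def)
    have inj: "inj_on \<E> J"
      using dis unfolding inj_on_def J_def disjoint_family_on_def by blast
    have "v = (\<Sum>i\<in>J. sqrt (real (card (\<E> i))))"
      unfolding v partition_cost_def J_def by (rule sum.mono_neutral_right) auto
    also have "\<dots> = (\<Sum>F\<in>\<E> ` J. sqrt (real (card F)))"
      by (simp add: sum.reindex[OF inj])
    finally show "v \<in> (\<lambda>\<F>. \<Sum>F\<in>\<F>. sqrt (real (card F))) ` Pow (Pow \<A>)"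
      using un by (auto simp: J_def)
  qed
  then have fin: "finite ?V"
    using finA by (meson finite_Pow_iff finite_imageI finite_subset)
  obtain xs where xs: "set xs = \<A>" "distinct xs"
    using finite_distinct_list[OF finA] by blast
  have "elementary_partition \<A> (length xs) (\<lambda>i. {xs ! i})"
    unfolding elementary_partition_def
  proof (intro conjI allI impI)
    fix i assume "i < length xs"
    then have "xs ! i \<subseteq> X"
      using xs assms by (metis PowD nth_mem subsetD)
    then show "elementary_family {xs ! i}"
      using assms by (meson elementary_singleton finite_subset)
  next
    show "disjoint_family_on (\<lambda>i. {xs ! i}) {..<length xs}"
      using xs by (auto simp: disjoint_family_on_def nth_eq_iff_index_eq)
  next
    show "(\<Union>i<length xs. {xs ! i}) = \<A>"
      using xs by (force simp: in_set_conv_nth)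
  qed
  then have ne: "?V \<noteq> {}"
    by blast
  have min: "elem_pi \<A> = Min ?V"
    unfolding elem_pi_def using fin ne by (rule cInf_eq_Min)
  show "\<exists>N \<E>. elementary_partition \<A> N \<E> \<and> elem_pi \<A> = partition_cost N \<E>"
    using Min_in[OF fin ne] unfolding min by blast
  show "elementary_partition \<A> N \<E> \<Longrightarrow> elem_pi \<A> \<le> partition_cost N \<E>"
    unfolding min using fin by (intro Min_le) blast+
qed

end

theory Submission
  imports Defs
begin

text \<open>Halve an interval of at most \<open>2 ^ Suc s\<close> points and sort the \<open>k\<close>-subsets by the size \<open>i\<close> of
  their trace on the left half. Partitions of families on disjoint ground sets multiply, so the costs
  obey \<open>f (s + 1) k \<le> \<Sum>i\<le>k. f s i * f s (k - i)\<close>. The bound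
  \<open>D ^ (k - 1) / sqrt k * (2 ^ s / k) powr (k / 2)\<close> with \<open>D = (2 + sqrt 2) * c\<close> is preserved
  by this recursion for \<open>k \<ge> 3\<close>: the two extreme terms contribute at most a fraction \<open>1 / sqrt 2\<close>
  of it, and by the hypothesis on \<open>c\<close> the others contribute at most a fraction
  \<open>1 / (2 + sqrt 2) = 1 - 1 / sqrt 2\<close>. Rounding \<open>n\<close> up to a power of two costs the factor \<open>2\<close>
  in the base of the final power.\<close>

section \<open>Joins of families on disjoint ground sets\<close>

lemma family_join_assoc: "family_join (family_join \<A> \<B>) \<C> = family_join \<A> (family_join \<B> \<C>)"
proof (intro set_eqI iffI)
  fix S assume "S \<in> family_join (family_join \<A> \<B>) \<C>"
  then obtain A B C where "S = (A \<union> B) \<union> C" "A \<in> \<A>" "B \<in> \<B>" "C \<in> \<C>"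
    by (auto simp: family_join_def)
  then show "S \<in> family_join \<A> (family_join \<B> \<C>)"
    unfolding family_join_def using Un_assoc[of A B C] by blast
next
  fix S assume "S \<in> family_join \<A> (family_join \<B> \<C>)"
  then obtain A B C where "S = A \<union> (B \<union> C)" "A \<in> \<A>" "B \<in> \<B>" "C \<in> \<C>"
    by (auto simp: family_join_def)
  then show "S \<in> family_join (family_join \<A> \<B>) \<C>"
    unfolding family_join_def using Un_assoc[of A B C] by blast
qed

lemma family_join_empty [simp]: "family_join {} \<B> = {}" "family_join \<A> {} = {}"
  by (auto simp: family_join_def)

lemma family_join_neutral [simp]: "family_join {{}} \<B> = \<B>" "family_join \<A> {{}} = \<A>"
  by (auto simp: family_join_def)

lemma family_join_Un:
  "family_join (\<A> \<union> \<A>') \<B> = family_join \<A> \<B> \<union> family_join \<A>' \<B>"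
  "family_join \<A> (\<B> \<union> \<B>') = family_join \<A> \<B> \<union> family_join \<A> \<B>'"
  by (auto simp: family_join_def)

lemma foldr_family_join_append:
  "foldr family_join (xs @ ys) {{}} = family_join (foldr family_join xs {{}}) (foldr family_join ys {{}})"
  by (induction xs) (simp_all add: family_join_assoc)

text \<open>Intersecting the union with \<open>X\<close> and with \<open>Y\<close> recovers the two
  parts. Cardinalities and disjointness therefore pass from products of families to joins.\<close>

lemma inj_on_Un_disjoint:
  assumes "\<A> \<subseteq> Pow X" "\<B> \<subseteq> Pow Y" "X \<inter> Y = {}"
  shows "inj_on (\<lambda>(A, B). A \<union> B) (\<A> \<times> \<B>)"
proof (rule inj_onI, clarify)
  fix A B A' B' assume "A \<in> \<A>" "B \<in> \<B>" "A' \<in> \<A>" "B' \<in> \<B>" and eq: "A \<union> B = A' \<union> B'"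
  then have "A \<subseteq> X" "A' \<subseteq> X" "B \<subseteq> Y" "B' \<subseteq> Y"
    using assms by auto
  then show "A = A' \<and> B = B'"
    using eq assms(3) by blast
qed

lemma family_join_eq_image: "family_join \<A> \<B> = (\<lambda>(A, B). A \<union> B) ` (\<A> \<times> \<B>)"
  by (auto simp: family_join_def)

lemma card_family_join:
  assumes "\<A> \<subseteq> Pow X" "\<B> \<subseteq> Pow Y" "X \<inter> Y = {}"
  shows "card (family_join \<A> \<B>) = card \<A> * card \<B>"
  unfolding family_join_eq_image
  by (simp add: card_image[OF inj_on_Un_disjoint[OF assms]] card_cartesian_product)

lemma family_join_disjoint:
  assumes "\<A> \<union> \<A>' \<subseteq> Pow X" "\<B> \<union> \<B>' \<subseteq> Pow Y" "X \<inter> Y = {}" "\<A> \<inter> \<A>' = {} \<or> \<B> \<inter> \<B>' = {}"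
  shows "family_join \<A> \<B> \<inter> family_join \<A>' \<B>' = {}"
proof -
  \<comment> \<open>Injectivity is used for the larger families \<open>\<A> \<union> \<A>'\<close>
    and \<open>\<B> \<union> \<B>'\<close>, so that both products lie in its domain and the image
    commutes with their intersection.\<close>
  have "family_join \<A> \<B> \<inter> family_join \<A>' \<B>' = (\<lambda>(A, B). A \<union> B) ` (\<A> \<times> \<B> \<inter> \<A>' \<times> \<B>')"
    unfolding family_join_eq_image
    by (rule inj_on_image_Int[OF inj_on_Un_disjoint[OF assms(1-3)], symmetric]) auto
  then show ?thesis
    using assms(4) by auto
qed

section \<open>Elementary families inside a ground set\<close>

text \<open>A factor \<open>nsets I 0\<close> leaves no trace of \<open>I\<close> in the family, so the requirement that the
  intervals lie in the ground set has to be recorded separately. Without it the join of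
  elementary families on disjoint ground sets need not visibly be elementary.\<close>

definition elementary_on :: "int set \<Rightarrow> int set set \<Rightarrow> bool" where
  "elementary_on X \<E> \<longleftrightarrow>
     (\<exists>l I k. l \<ge> (1::nat) \<and> (\<forall>j<l. int_interval (I j) \<and> I j \<subseteq> X \<and> k j \<in> {0, 1, 2}) \<and>
        disjoint_family_on I {..<l} \<and>
        \<E> = foldr family_join (map (\<lambda>j. nsets (I j) (k j)) [0..<l]) {{}})"

lemma elementary_on_imp_elementary: "elementary_on X \<E> \<Longrightarrow> elementary_family \<E>"
  unfolding elementary_on_def elementary_family_def by (elim ex_forward) simp

lemma elementary_on_subset_Pow:
  assumes "elementary_on X \<E>" shows "\<E> \<subseteq> Pow X"
proof -
  obtain l I k where I: "\<forall>j<(l::nat). I j \<subseteq> X"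
    and E: "\<E> = foldr family_join (map (\<lambda>j. nsets (I j) (k j)) [0..<l]) {{}}"
    using assms unfolding elementary_on_def by blast
  \<comment> \<open>Arbitrary index lists replace \<open>[0..<l]\<close>, so that the induction can
    peel off the head.\<close>
  have "foldr family_join (map (\<lambda>j. nsets (I j) (k j)) js) {{}} \<subseteq> Pow X" if "set js \<subseteq> {..<l}" for js
    using that
  proof (induction js)
    case (Cons j js)
    then have "I j \<subseteq> X"
      using I by simp
    then have "nsets (I j) (k j) \<subseteq> Pow X"
      by (auto simp: nsets_def)
    moreover have "foldr family_join (map (\<lambda>j. nsets (I j) (k j)) js) {{}} \<subseteq> Pow X"
      using Cons by simp
    ultimately show ?case
      unfolding list.map foldr.simps comp_def family_join_def by blast
  qed simp
  from this[of "[0..<l]"] show ?thesis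
    by (simp add: E atLeast0LessThan)
qed

lemma elementary_on_nsets:
  assumes "int_interval X" "k \<le> 2"
  shows "elementary_on X (nsets X k)"
proof -
  have "k \<in> {0, 1, 2}"
    using assms(2) by auto
  then show ?thesis
    unfolding elementary_on_def using assms(1)
    by (intro exI[of _ 1] exI[of _ "\<lambda>_. X"] exI[of _ "\<lambda>_. k"]) (auto simp: disjoint_family_on_def)
qed

text \<open>The two sequences of intervals are concatenated. Intervals from different sequences are
  disjoint because they lie in \<open>X\<close> and in \<open>Y\<close>.\<close>

lemma elementary_on_join:
  assumes "elementary_on X \<E>" "elementary_on Y \<F>" "X \<inter> Y = {}"
  shows "elementary_on (X \<union> Y) (family_join \<E> \<F>)"
proof -
  obtain l I k where l: "l \<ge> (1::nat)"
    and I: "\<forall>j<l. int_interval (I j) \<and> I j \<subseteq> X \<and> k j \<in> {0, 1, 2}"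
    and dI: "disjoint_family_on I {..<l}"
    and E: "\<E> = foldr family_join (map (\<lambda>j. nsets (I j) (k j)) [0..<l]) {{}}"
    using assms(1) unfolding elementary_on_def by blast
  obtain l' I' k' where l': "l' \<ge> (1::nat)"
    and I': "\<forall>j<l'. int_interval (I' j) \<and> I' j \<subseteq> Y \<and> k' j \<in> {0, 1, 2}"
    and dI': "disjoint_family_on I' {..<l'}"
    and F: "\<F> = foldr family_join (map (\<lambda>j. nsets (I' j) (k' j)) [0..<l']) {{}}"
    using assms(2) unfolding elementary_on_def by blast
  define J where "J = (\<lambda>j. if j < l then I j else I' (j - l))"
  define h where "h = (\<lambda>j. if j < l then k j else k' (j - l))"
  have "map (\<lambda>j. nsets (J j) (h j)) [0..<l + l'] =
      map (\<lambda>j. nsets (I j) (k j)) [0..<l] @ map (\<lambda>j. nsets (I' j) (k' j)) [0..<l']"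
    by (rule nth_equalityI) (auto simp: J_def h_def nth_append)
  then have "family_join \<E> \<F> = foldr family_join (map (\<lambda>j. nsets (J j) (h j)) [0..<l + l']) {{}}"
    by (simp only: E F foldr_family_join_append)
  moreover have "\<forall>j<l + l'. int_interval (J j) \<and> J j \<subseteq> X \<union> Y \<and> h j \<in> {0, 1, 2}"
  proof (intro allI impI)
    fix j assume j: "j < l + l'"
    show "int_interval (J j) \<and> J j \<subseteq> X \<union> Y \<and> h j \<in> {0, 1, 2}"
    proof (cases "j < l")
      case True
      then show ?thesis using I by (auto simp: J_def h_def)
    next
      case False
      then have "j - l < l'" using j by simp
      then show ?thesis using I' False by (auto simp: J_def h_def)
    qed
  qed
  moreover have "disjoint_family_on J {..<l + l'}"
    unfolding disjoint_family_on_def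
  proof (intro ballI impI)
    fix i j assume ij: "i \<in> {..<l + l'}" "j \<in> {..<l + l'}" "i \<noteq> j"
    \<comment> \<open>In the last case \<open>i \<noteq> j\<close> survives the truncated
      subtraction because both indices are at least \<open>l\<close>.\<close>
    consider "i < l" "j < l" | "i < l" "\<not> j < l" "j - l < l'" | "\<not> i < l" "j < l" "i - l < l'"
      | "\<not> i < l" "\<not> j < l" "i - l < l'" "j - l < l'" "i - l \<noteq> j - l"
      using ij by force
    then show "J i \<inter> J j = {}"
    proof cases
      case 1
      then show ?thesis using dI ij by (auto simp: J_def disjoint_family_on_def)
    next
      case 2
      then have "J i \<subseteq> X" "J j \<subseteq> Y" using I I' by (auto simp: J_def)
      then show ?thesis using assms(3) by blast
    next
      case 3
      then have "J i \<subseteq> Y" "J j \<subseteq> X" using I I' by (auto simp: J_def)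
      then show ?thesis using assms(3) by blast
    next
      case 4
      then have "I' (i - l) \<inter> I' (j - l) = {}"
        using dI' unfolding disjoint_family_on_def by blast
      then show ?thesis using 4 by (simp add: J_def)
    qed
  qed
  moreover have "l + l' \<ge> 1"
    using l by simp
  ultimately show ?thesis
    unfolding elementary_on_def
    by (intro exI[of _ "l + l'"] exI[of _ J] exI[of _ h] conjI)
qed

section \<open>Costs of partitions into elementary families\<close>

text \<open>A certificate that some partition into elementary families on \<open>X\<close> costs at
  most the given number. Adding one piece at a time lets unions and joins be treated by induction
  instead of by reindexing sequences; the inequality in each rule makes the certificate monotone in
  the bound.\<close>

inductive elem_cost_le :: "int set \<Rightarrow> int set set \<Rightarrow> real \<Rightarrow> bool" for X where
  empty: "0 \<le> v \<Longrightarrow> elem_cost_le X {} v"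
| insert: "elementary_on X \<E> \<Longrightarrow> elem_cost_le X \<A> v \<Longrightarrow> \<E> \<inter> \<A> = {} \<Longrightarrow>
    sqrt (real (card \<E>)) + v \<le> w \<Longrightarrow> elem_cost_le X (\<E> \<union> \<A>) w"

lemma elem_cost_le_nonneg: "elem_cost_le X \<A> v \<Longrightarrow> 0 \<le> v"
proof (induction rule: elem_cost_le.induct)
  case (insert \<E> \<A> v w)
  have "0 \<le> sqrt (real (card \<E>))" by simp
  then show ?case using insert by linarith
qed

lemma elem_cost_le_subset_Pow: "elem_cost_le X \<A> v \<Longrightarrow> \<A> \<subseteq> Pow X"
  by (induction rule: elem_cost_le.induct) (auto dest: elementary_on_subset_Pow)

lemma elem_cost_le_mono:
  assumes "elem_cost_le X \<A> v" "v \<le> w"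
  shows "elem_cost_le X \<A> w"
  using assms(1)
proof cases
  case empty
  then show ?thesis using assms(2) by (auto intro: elem_cost_le.empty)
next
  case (insert \<E> \<A>' v')
  then show ?thesis
    using assms(2) elem_cost_le.insert[of X \<E> \<A>' v' w] by simp
qed

lemma elem_cost_le_elementary:
  assumes "elementary_on X \<E>" "sqrt (real (card \<E>)) \<le> v"
  shows "elem_cost_le X \<E> v"
  using elem_cost_le.insert[OF assms(1) elem_cost_le.empty[of 0], of v] assms(2) by simp

lemma elem_cost_le_Un:
  assumes "elem_cost_le X \<A> v" "elem_cost_le X \<B> w" "\<A> \<inter> \<B> = {}"
  shows "elem_cost_le X (\<A> \<union> \<B>) (v + w)"
  using assms(1,3)
proof (induction rule: elem_cost_le.induct)
  case (empty v)
  then show ?case using elem_cost_le_mono[OF assms(2)] by simp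
next
  case (insert \<E> \<A> v u)
  then have "elem_cost_le X (\<A> \<union> \<B>) (v + w)" "\<E> \<inter> (\<A> \<union> \<B>) = {}"
    by blast+
  then have "elem_cost_le X (\<E> \<union> (\<A> \<union> \<B>)) (u + w)"
    using insert.hyps by (auto intro: elem_cost_le.insert[where \<E> = \<E> and v = "v + w"])
  then show ?case by (simp add: Un_assoc)
qed

lemma elem_cost_le_UN:
  assumes "finite S" "\<And>i. i \<in> S \<Longrightarrow> elem_cost_le X (\<A> i) (v i)" "disjoint_family_on \<A> S"
  shows "elem_cost_le X (\<Union>i\<in>S. \<A> i) (\<Sum>i\<in>S. v i)"
  using assms
proof (induction S rule: finite_induct)
  case empty
  then show ?case by (simp add: elem_cost_le.empty)
next
  case (insert i S)
  have "\<A> i \<inter> (\<Union>j\<in>S. \<A> j) = {}"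
    using insert.prems(2) insert.hyps(2) by (subst (asm) disjoint_family_on_insert) auto
  moreover have "elem_cost_le X (\<Union>j\<in>S. \<A> j) (\<Sum>j\<in>S. v j)"
    using insert by (simp add: disjoint_family_on_insert)
  ultimately show ?case
    using insert.hyps insert.prems(1)[of i] by (simp add: elem_cost_le_Un)
qed

text \<open>Joining every piece of one partition with every piece of the other partitions the join.
  As \<open>sqrt (card _)\<close> is multiplicative on such joins, the double sum of costs factors.
  The induction on the second partition, for one fixed piece \<open>\<E>\<close> of the first, comes
  before the induction on the first.\<close>

lemma elem_cost_le_join:
  assumes "elem_cost_le X \<A> v" "elem_cost_le Y \<B> w" "X \<inter> Y = {}"
  shows "elem_cost_le (X \<union> Y) (family_join \<A> \<B>) (v * w)"
proof -
  have elem: "elem_cost_le (X \<union> Y) (family_join \<E> \<B>) (sqrt (real (card \<E>)) * w)"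
    if E: "elementary_on X \<E>" for \<E>
    using assms(2)
  proof (induction rule: elem_cost_le.induct)
    case (empty v)
    then show ?case by (simp add: elem_cost_le.empty)
  next
    case (insert \<F> \<B> v w)
    have P: "\<E> \<subseteq> Pow X" "\<F> \<subseteq> Pow Y" "\<B> \<subseteq> Pow Y"
      using E insert by (auto dest: elementary_on_subset_Pow elem_cost_le_subset_Pow)
    have "sqrt (real (card (family_join \<E> \<F>))) + sqrt (real (card \<E>)) * v =
        sqrt (real (card \<E>)) * (sqrt (real (card \<F>)) + v)"
      by (simp add: card_family_join[OF P(1,2) assms(3)] real_sqrt_mult distrib_left)
    also have "\<dots> \<le> sqrt (real (card \<E>)) * w"
      using insert by (intro mult_left_mono) auto
    finally show ?case
      unfolding family_join_Un
      using P insert E assms(3)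
      by (intro elem_cost_le.insert[OF elementary_on_join insert.IH] family_join_disjoint[where X = X and Y = Y])
        auto
  qed
  show ?thesis
    using assms(1)
  proof (induction rule: elem_cost_le.induct)
    case (empty v)
    then show ?case using elem_cost_le_nonneg[OF assms(2)] by (simp add: elem_cost_le.empty)
  next
    case (insert \<E> \<A> v u)
    have "family_join \<E> \<B> \<inter> family_join \<A> \<B> = {}"
      using elementary_on_subset_Pow[OF insert.hyps(1)] elem_cost_le_subset_Pow[OF insert.hyps(2)]
        elem_cost_le_subset_Pow[OF assms(2)] insert.hyps(3) assms(3)
      by (intro family_join_disjoint[where X = X and Y = Y]) auto
    then have "elem_cost_le (X \<union> Y) (family_join \<E> \<B> \<union> family_join \<A> \<B>)
        (sqrt (real (card \<E>)) * w + v * w)"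
      using elem[OF insert.hyps(1)] insert.IH by (intro elem_cost_le_Un) auto
    moreover have "sqrt (real (card \<E>)) * w + v * w \<le> u * w"
      using mult_right_mono[OF insert.hyps(4) elem_cost_le_nonneg[OF assms(2)]]
      by (simp add: distrib_right)
    ultimately show ?case
      unfolding family_join_Un by (rule elem_cost_le_mono)
  qed
qed

text \<open>Leads back from certificates to indexed partitions: each inserted family takes the next
  free index, and the ground set is forgotten.\<close>

lemma elem_cost_le_partition:
  assumes "elem_cost_le X \<A> v"
  shows "\<exists>N \<E>. elementary_partition \<A> N \<E> \<and> partition_cost N \<E> \<le> v"
  using assms
proof (induction rule: elem_cost_le.induct)
  case (empty v)
  then show ?case
    by (intro exI[of _ 0]) (simp add: elementary_partition_def partition_cost_def disjoint_family_on_def)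
next
  case (insert \<F> \<A> v w)
  then obtain N \<E> where p: "elementary_partition \<A> N \<E>" and cost: "partition_cost N \<E> \<le> v"
    by blast
  let ?E = "\<E>(N := \<F>)"
  have "disjoint_family_on \<E> {..<N}" and un: "(\<Union>i<N. \<E> i) = \<A>"
    using p by (auto simp: elementary_partition_def)
  then have "disjoint_family_on ?E {..<Suc N}"
    using insert.hyps(3) unfolding lessThan_Suc
    by (subst disjoint_family_on_insert) (auto simp: disjoint_family_on_def)
  moreover have "(\<Union>i<Suc N. ?E i) = \<F> \<union> \<A>"
    using un by (auto simp: lessThan_Suc)
  moreover have "\<forall>i<Suc N. elementary_family (?E i)"
    using p elementary_on_imp_elementary[OF insert.hyps(1)]
    by (auto simp: elementary_partition_def less_Suc_eq)
  ultimately have "elementary_partition (\<F> \<union> \<A>) (Suc N) ?E"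
    by (simp add: elementary_partition_def)
  moreover have "partition_cost (Suc N) ?E \<le> w"
    using cost insert.hyps(4) by (simp add: partition_cost_def)
  ultimately show ?case by blast
qed

lemma elem_pi_le:
  assumes "finite X" "elem_cost_le X \<A> v"
  shows "elem_pi \<A> \<le> v"
  using elem_cost_le_partition[OF assms(2)] elem_pi_attained(2)[OF assms(1) elem_cost_le_subset_Pow[OF assms(2)]]
  by force

section \<open>Splitting the subsets of a disjoint union\<close>

text \<open>Vandermonde's identity at the level of families: the index \<open>i\<close> is the size
  of the trace on \<open>X\<close>.\<close>

lemma nsets_Un_disjoint:
  fixes X Y :: "int set"
  assumes "finite X" "finite Y" "X \<inter> Y = {}"
  shows "nsets (X \<union> Y) k = (\<Union>i\<le>k. family_join (nsets X i) (nsets Y (k - i)))"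
proof (intro set_eqI iffI)
  fix S assume S: "S \<in> nsets (X \<union> Y) k"
  then have fin: "finite S" and "S \<subseteq> X \<union> Y" and "card S = k"
    by (auto simp: nsets_def)
  then have eq: "S = (S \<inter> X) \<union> (S \<inter> Y)"
    by blast
  have "card S = card (S \<inter> X) + card (S \<inter> Y)"
    using card_Un_disjoint[of "S \<inter> X" "S \<inter> Y"] fin eq assms(3) by auto
  then have "card (S \<inter> X) \<le> k" "card (S \<inter> Y) = k - card (S \<inter> X)"
    using \<open>card S = k\<close> by auto
  then have "S \<inter> X \<in> nsets X (card (S \<inter> X))" "S \<inter> Y \<in> nsets Y (k - card (S \<inter> X))" "card (S \<inter> X) \<in> {..k}"
    using fin by (auto simp: nsets_def)
  then show "S \<in> (\<Union>i\<le>k. family_join (nsets X i) (nsets Y (k - i)))"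
    unfolding family_join_def using eq by blast
next
  fix S assume "S \<in> (\<Union>i\<le>k. family_join (nsets X i) (nsets Y (k - i)))"
  then obtain i A B where "i \<le> k" "A \<in> nsets X i" "B \<in> nsets Y (k - i)" "S = A \<union> B"
    by (auto simp: family_join_def)
  moreover from this have "card (A \<union> B) = card A + card B"
    using assms(3) by (intro card_Un_disjoint) (auto simp: nsets_def)
  ultimately show "S \<in> nsets (X \<union> Y) k"
    by (auto simp: nsets_def)
qed

text \<open>One function \<open>v\<close> serves both sides, since the two halves of an interval
  will obey the same size bound. Different \<open>i\<close> give disjoint joins because the traces
  on \<open>X\<close> differ in size.\<close>

lemma elem_cost_le_nsets_Un:
  assumes "finite X" "finite Y" "X \<inter> Y = {}"
    and "\<And>i. i \<le> k \<Longrightarrow> elem_cost_le X (nsets X i) (v i)"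
    and "\<And>i. i \<le> k \<Longrightarrow> elem_cost_le Y (nsets Y i) (v i)"
  shows "elem_cost_le (X \<union> Y) (nsets (X \<union> Y) k) (\<Sum>i\<le>k. v i * v (k - i))"
  unfolding nsets_Un_disjoint[OF assms(1-3)]
proof (rule elem_cost_le_UN)
  show "disjoint_family_on (\<lambda>i. family_join (nsets X i) (nsets Y (k - i))) {..k}"
    unfolding disjoint_family_on_def
  proof (intro ballI impI)
    fix i j :: nat assume "i \<noteq> j"
    then have "nsets X i \<inter> nsets X j = {}"
      by (auto simp: nsets_def)
    then show "family_join (nsets X i) (nsets Y (k - i)) \<inter> family_join (nsets X j) (nsets Y (k - j)) = {}"
      using assms(3) by (intro family_join_disjoint[where X = X and Y = Y]) (auto simp: nsets_def)
  qed
qed (use assms in \<open>auto intro: elem_cost_le_join\<close>)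

section \<open>The numerical recursion\<close>

text \<open>Here \<open>x\<close> bounds the number of points. The value at \<open>k = 0\<close> is
  set apart: the family \<open>{{}}\<close> costs 1, whereas the formula would give 0 through
  division by zero.\<close>

definition halving_bound :: "real \<Rightarrow> nat \<Rightarrow> real \<Rightarrow> real" where
  "halving_bound D k x =
     (if k = 0 then 1 else D ^ (k - 1) / sqrt (real k) * (x / real k) powr (real k / 2))"

lemma halving_bound_nonneg: "0 \<le> D \<Longrightarrow> 0 \<le> halving_bound D k x"
  by (simp add: halving_bound_def)

text \<open>The exponents \<open>i - 1\<close> and \<open>k - i - 1\<close> of \<open>D\<close> add
  up to \<open>k - 2\<close>, one less than in the target; this spare factor \<open>D\<close> pays
  for the recursion. Writing \<open>x / i\<close> as \<open>x / k * (k / i)\<close> leaves exactly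
  the summand of the hypothesis on \<open>c\<close>.\<close>

lemma halving_bound_mult:
  assumes "0 < i" "i < k" "0 \<le> x"
  shows "halving_bound D i x * halving_bound D (k - i) x =
    D ^ (k - 2) * (x / real k) powr (real k / 2) *
      ((real k / real i) powr (real i / 2) * (real k / real (k - i)) powr (real (k - i) / 2)
        * (1 / sqrt (real (i * (k - i)))))"
proof -
  define j where "j = k - i"
  have k: "k = i + j" and j: "0 < j"
    using assms by (auto simp: j_def)
  have s: "x / real i = x / real k * (real k / real i)" "x / real j = x / real k * (real k / real j)"
    using assms j by (auto simp: k)
  have e: "(x / real k) powr (real k / 2) = (x / real k) powr (real i / 2) * (x / real k) powr (real j / 2)"
    by (simp add: k add_divide_distrib powr_add)
  have d: "D ^ (k - 2) = D ^ (i - 1) * D ^ (j - 1)"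
    unfolding power_add[symmetric] using assms j by (intro arg_cong[where f = "(^) D"]) (simp add: k)
  have "halving_bound D i x * halving_bound D j x =
      (D ^ (i - 1) * D ^ (j - 1)) * ((x / real i) powr (real i / 2) * (x / real j) powr (real j / 2))
        * (1 / sqrt (real (i * j)))"
    using assms j by (simp add: halving_bound_def real_sqrt_mult)
  also have "\<dots> = D ^ (k - 2) * (x / real k) powr (real k / 2) *
      ((real k / real i) powr (real i / 2) * (real k / real j) powr (real j / 2) * (1 / sqrt (real (i * j))))"
    unfolding d e s using assms(3) by (subst (1 2) powr_mult) auto
  finally show ?thesis
    by (simp add: j_def)
qed

lemma powr_half_of_nat: "0 < x \<Longrightarrow> x powr (real k / 2) = sqrt (x ^ k)"
  by (simp add: powr_half_sqrt[symmetric] powr_realpow[symmetric] powr_powr)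

lemma halving_bound_step:
  fixes c :: real
  assumes c: "c \<ge> 1"
    and sum: "(\<Sum>i=1..k-1. (real k / real i) powr (real i / 2)
          * (real k / real (k - i)) powr (real (k - i) / 2)
          * (1 / sqrt (real (i * (k - i)))))
        \<le> c * sqrt (2 ^ k / real k)"
    and k: "k \<ge> 3" and x: "x > 0" and D: "D = (2 + sqrt 2) * c"
  shows "(\<Sum>i\<le>k. halving_bound D i x * halving_bound D (k - i) x) \<le> halving_bound D k (2 * x)"
proof -
  let ?f = "\<lambda>i. halving_bound D i x * halving_bound D (k - i) x"
  let ?p = "(x / real k) powr (real k / 2)"
  \<comment> \<open>The target is \<open>D * ?t\<close>. Its factor \<open>D\<close> is shared out
    as \<open>(1 + sqrt 2) * c\<close> for the two extreme terms and \<open>c\<close> for all the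
    others.\<close>
  let ?t = "D ^ (k - 2) / sqrt (real k) * (2 * x / real k) powr (real k / 2)"
  have D0: "D > 0"
    using c by (simp add: D add_pos_nonneg)
  \<comment> \<open>Doubling \<open>x\<close> gains \<open>sqrt (2 ^ k)\<close>, which is the factor
    on the right of the hypothesis on \<open>c\<close>.\<close>
  have p2: "(2 * x / real k) powr (real k / 2) = sqrt (2 ^ k) * ?p"
  proof -
    have "2 * x / real k = 2 * (x / real k)" by simp
    then show ?thesis
      using x by (simp only: powr_mult) (simp add: powr_half_of_nat)
  qed
  have DD: "D ^ (k - 1) = D * D ^ (k - 2)"
  proof -
    have "k - 1 = Suc (k - 2)" using k by simp
    then show ?thesis by (simp only: power_Suc)
  qed
  have "{..k} = insert 0 (insert k {1..k-1})"
    using k by auto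
  \<comment> \<open>As \<open>halving_bound D 0 x = 1\<close>, the terms for \<open>i = 0\<close>
    and \<open>i = k\<close> both equal \<open>halving_bound D k x\<close>.\<close>
  then have "(\<Sum>i\<le>k. ?f i) = 2 * halving_bound D k x + (\<Sum>i=1..k-1. ?f i)"
    using k by (simp add: halving_bound_def)
  also have "(\<Sum>i=1..k-1. ?f i) \<le> c * ?t"
  proof -
    have "(\<Sum>i=1..k-1. ?f i) = D ^ (k - 2) * ?p * (\<Sum>i=1..k-1. (real k / real i) powr (real i / 2)
          * (real k / real (k - i)) powr (real (k - i) / 2) * (1 / sqrt (real (i * (k - i)))))"
      unfolding sum_distrib_left using k x by (intro sum.cong refl halving_bound_mult) auto
    also have "\<dots> \<le> D ^ (k - 2) * ?p * (c * sqrt (2 ^ k / real k))"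
      using D0 by (intro mult_left_mono[OF sum]) auto
    also have "\<dots> = c * ?t"
      unfolding p2 by (simp add: real_sqrt_divide)
    finally show ?thesis .
  qed
  also have "2 * halving_bound D k x \<le> (1 + sqrt 2) * c * ?t"
  proof -
    have "2 * sqrt 2 \<le> sqrt (2 ^ k)"
    proof -
      have "2 * sqrt 2 = sqrt (2 ^ 3)"
        using real_sqrt_mult[of 4 2] by simp
      also have "\<dots> \<le> sqrt (2 ^ k)"
        using k by (intro real_sqrt_le_mono power_increasing) auto
      finally show ?thesis .
    qed
    then have "(1 + sqrt 2) * (2 * sqrt 2) \<le> (1 + sqrt 2) * sqrt (2 ^ k)"
      by (intro mult_left_mono) auto
    \<comment> \<open>At \<open>k = 3\<close> this is an equality. The number
      \<open>2 + sqrt 2\<close> is the least \<open>a\<close> with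
      \<open>2 * a \<le> (a - 1) * (2 * sqrt 2)\<close>.\<close>
    then have q: "2 * (2 + sqrt 2) \<le> (1 + sqrt 2) * sqrt (2 ^ k)"
      by (simp add: algebra_simps)
    have "2 * halving_bound D k x = (2 * (2 + sqrt 2)) * (c * D ^ (k - 2) / sqrt (real k) * ?p)"
      using k unfolding halving_bound_def DD by (simp add: D)
    also have "\<dots> \<le> ((1 + sqrt 2) * sqrt (2 ^ k)) * (c * D ^ (k - 2) / sqrt (real k) * ?p)"
      using c D0 by (intro mult_right_mono[OF q]) auto
    also have "\<dots> = (1 + sqrt 2) * c * ?t"
      unfolding p2 by simp
    finally show ?thesis .
  qed
  also have "(1 + sqrt 2) * c * ?t + c * ?t = D * ?t"
    by (simp add: D algebra_simps add_divide_distrib)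
  also have "\<dots> = halving_bound D k (2 * x)"
    using k unfolding halving_bound_def DD by simp
  finally show ?thesis by simp
qed

section \<open>The bound for subsets of an interval\<close>

text \<open>For \<open>k \<le> 2\<close> the whole family is a single elementary piece. These sizes
  are kept out of the recursion: for \<open>k = 1\<close> and \<open>k = 2\<close> the two extreme
  terms alone already reach or exceed \<open>halving_bound D k (2 * x)\<close>.\<close>

lemma elem_cost_le_nsets_small:
  assumes "int_interval X" "k \<le> 2" "real (card X) \<le> x" "0 < x" "D \<ge> 2"
  shows "elem_cost_le X (nsets X k) (halving_bound D k x)"
proof (rule elem_cost_le_elementary)
  show "elementary_on X (nsets X k)"
    using assms by (intro elementary_on_nsets)
  have fin: "finite X"
    using assms(1) by (auto simp: int_interval_def)
  consider "k = 0" | "k = 1" | "k = 2"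
    using assms(2) by linarith
  then show "sqrt (real (card (nsets X k))) \<le> halving_bound D k x"
  proof cases
    case 1
    then show ?thesis by (simp add: halving_bound_def)
  next
    case 2
    then show ?thesis
      using assms by (simp add: halving_bound_def powr_half_sqrt)
  next
    case 3
    let ?m = "real (card X)"
    have "2 * (card X choose 2) \<le> card X ^ 2"
    proof -
      have "2 * (card X choose 2) \<le> card X * (card X - 1)"
        unfolding choose_two by (rule times_div_less_eq_dividend)
      also have "\<dots> \<le> card X ^ 2"
        by (simp add: power2_eq_square)
      finally show ?thesis .
    qed
    then have "real (2 * (card X choose 2)) \<le> real (card X ^ 2)"
      by (rule of_nat_mono)
    then have "2 * real (card X choose 2) \<le> ?m ^ 2"
      by simp
    also have "\<dots> \<le> x ^ 2"
      using assms by (intro power_mono) auto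
    finally have "sqrt (real (card X choose 2)) \<le> sqrt (x ^ 2 / 2)"
      by (intro real_sqrt_le_mono) simp
    \<comment> \<open>The factor \<open>2 / sqrt 2\<close> is exposed in order to be compared with
      \<open>D / sqrt 2\<close>; this is where \<open>D \<ge> 2\<close> enters.\<close>
    also have "\<dots> = 2 / sqrt 2 * (x / 2)"
      using assms by (simp add: real_sqrt_divide)
    also have "\<dots> \<le> D / sqrt 2 * (x / 2)"
      using assms by (intro mult_right_mono divide_right_mono) auto
    finally show ?thesis
      using 3 assms fin by (simp add: halving_bound_def card_nsets)
  qed
qed

lemma int_interval_split:
  assumes "int_interval X" "card X \<le> a + b"
  obtains Y Z where "int_interval Y" "int_interval Z" "X = Y \<union> Z" "Y \<inter> Z = {}" "card Y \<le> a" "card Z \<le> b"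
proof -
  obtain l u where X: "X = {l..u}"
    using assms(1) by (auto simp: int_interval_def)
  show ?thesis
  \<comment> \<open>The cut comes after the first \<open>a\<close> points; the minimum covers an
    interval with fewer points, whose second part is empty.\<close>
  proof (rule that[of "{l..min u (l + int a - 1)}" "{l + int a..u}"])
    show "card {l + int a..u} \<le> b"
      using assms(2) by (simp add: X)
  qed (auto simp: X int_interval_def)
qed

lemma elem_cost_le_nsets_interval:
  fixes c :: real
  assumes c: "c \<ge> 1"
    and sum: "\<And>k::nat. k \<ge> 1 \<Longrightarrow>
      (\<Sum>i=1..k-1. (real k / real i) powr (real i / 2)
          * (real k / real (k - i)) powr (real (k - i) / 2)
          * (1 / sqrt (real (i * (k - i)))))
        \<le> c * sqrt (2 ^ k / real k)"
    and D: "D = (2 + sqrt 2) * c"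
    and X: "int_interval X" "card X \<le> 2 ^ s"
  shows "elem_cost_le X (nsets X k) (halving_bound D k (2 ^ s))"
proof -
  have D2: "D \<ge> 2"
    using mult_mono[of 2 "2 + sqrt 2" 1 c] c by (simp add: D)
  show ?thesis
    using X
  \<comment> \<open>Both \<open>X\<close> and \<open>k\<close> vary, since the step calls on both
    halves and on all sizes \<open>i \<le> k\<close>.\<close>
  proof (induction s arbitrary: X k)
    case 0
    then have fin: "finite X" by (auto simp: int_interval_def)
    show ?case
    proof (cases "k \<le> 2")
      case True
      then show ?thesis using 0 D2 by (intro elem_cost_le_nsets_small) auto
    next
      case False
      \<comment> \<open>An interval with at most one point has no subsets of size at least 3, so the
        empty partition does.\<close>
      have "nsets X k = {}"
      proof (rule ccontr)
        assume "nsets X k \<noteq> {}"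
        then obtain S where "S \<subseteq> X" "card S = k"
          by (auto simp: nsets_def)
        then show False
          using card_mono[OF fin, of S] 0 False by simp
      qed
      then show ?thesis
        using D2 by (simp add: elem_cost_le.empty halving_bound_nonneg)
    qed
  next
    case (Suc s)
    show ?case
    proof (cases "k \<le> 2")
      case True
      have "real (card X) \<le> 2 ^ Suc s"
        using of_nat_mono[OF Suc.prems(2), where ?'a = real] by simp
      then show ?thesis
        using True Suc.prems D2 by (intro elem_cost_le_nsets_small) auto
    next
      case False
      obtain Y Z where YZ: "int_interval Y" "int_interval Z" "X = Y \<union> Z" "Y \<inter> Z = {}"
        "card Y \<le> 2 ^ s" "card Z \<le> 2 ^ s"
        using int_interval_split[of X "2 ^ s" "2 ^ s"] Suc.prems by auto
      have fin: "finite Y" "finite Z"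
        using YZ by (auto simp: int_interval_def)
      have "elem_cost_le X (nsets X k)
          (\<Sum>i\<le>k. halving_bound D i (2 ^ s) * halving_bound D (k - i) (2 ^ s))"
        unfolding YZ(3) using Suc.IH YZ fin by (intro elem_cost_le_nsets_Un) auto
      moreover have "(\<Sum>i\<le>k. halving_bound D i (2 ^ s) * halving_bound D (k - i) (2 ^ s))
          \<le> halving_bound D k (2 * 2 ^ s)"
        using False by (intro halving_bound_step[OF c sum _ _ D]) auto
      ultimately show ?thesis
        by (auto intro: elem_cost_le_mono)
    qed
  qed
qed

section \<open>From powers of two to arbitrary \<open>n\<close>\<close>

lemma ex_power_two_between:
  assumes "n \<ge> (1::nat)"
  obtains s where "n \<le> 2 ^ s" "2 ^ s \<le> 2 * n"
proof -
  obtain s where s: "2 ^ s \<le> n" "n < 2 ^ (s + 1)"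
    using ex_power_ivl1[of 2 n] assms by auto
  then show ?thesis
    by (intro that[of "s + 1"]) auto
qed

theorem theorem3p9:
  fixes c :: real
  assumes "c \<ge> 1"
    and "\<And>k::nat. k \<ge> 1 \<Longrightarrow>
      (\<Sum>i=1..k-1. (real k / real i) powr (real i / 2)
          * (real k / real (k - i)) powr (real (k - i) / 2)
          * (1 / sqrt (real (i * (k - i)))))
        \<le> c * sqrt (2 ^ k / real k)"
  shows "\<forall>n k :: nat. n \<ge> 1 \<longrightarrow> k \<ge> 1 \<longrightarrow>
      elem_pi (k_subsets n k)
        \<le> (2 + sqrt 2) ^ (k - 1) * c ^ (k - 1) / sqrt (real k)
            * (2 * real n / real k) powr (real k / 2)"
proof (intro allI impI)
  fix n k :: nat assume n: "n \<ge> 1" and k: "k \<ge> 1"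
  let ?D = "(2 + sqrt 2) * c"
  obtain s where s: "n \<le> 2 ^ s" "2 ^ s \<le> 2 * n"
    using ex_power_two_between[OF n] .
  have s': "2 ^ s \<le> 2 * real n"
    using of_nat_mono[OF s(2), where ?'a = real] by simp
  have "int_interval {1..int n}"
    by (auto simp: int_interval_def)
  then have "elem_cost_le {1..int n} (k_subsets n k) (halving_bound ?D k (2 ^ s))"
    unfolding k_subsets_def using s(1)
    by (intro elem_cost_le_nsets_interval[OF assms refl]) auto
  then have "elem_pi (k_subsets n k) \<le> halving_bound ?D k (2 ^ s)"
    by (intro elem_pi_le) auto
  \<comment> \<open>The bound grows with its size argument, so \<open>2 ^ s\<close> may be raised to
    \<open>2 * n\<close>; \<open>k \<ge> 1\<close> selects the generic branch of
    \<open>halving_bound\<close>.\<close>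
  also have "\<dots> \<le> ?D ^ (k - 1) / sqrt (real k) * (2 * real n / real k) powr (real k / 2)"
    using k s' assms(1) unfolding halving_bound_def
    by (auto intro!: mult_left_mono powr_mono2 divide_right_mono divide_nonneg_nonneg)
  finally show "elem_pi (k_subsets n k)
      \<le> (2 + sqrt 2) ^ (k - 1) * c ^ (k - 1) / sqrt (real k)
          * (2 * real n / real k) powr (real k / 2)"
    by (simp add: power_mult_distrib)
qed

end
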